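(* For any $n \geq 10$, $sat(K_4^n, C_5) = 4n+2$.
   Context: All graphs are finite, simple and undirected. $K_k^n$ denotes the complete $k$-partite graph with exactly $n$ vertices in each of its $k$ parts. $C_5$ is the cycle on $5$ vertices. For graphs $G$ and $F$, a spanning subgraph $H$ of $G$ is $F$-saturated relative to $G$ if $H$ contains no copy of $F$ but $H+e$ contains a copy of $F$ for every $e\in E(G)\setminus E(H)$; $sat(G,F)$ is the minimum number of edges of a graph that is $F$-saturated relative to $G$. *)

theory Defs
  imports Main
begin

type_synonym 'a graph = "'a set \<times> 'a set set"

abbreviation verts :: "'a graph \<Rightarrow> 'a set" where
  "verts G \<equiv> fst G"

abbreviation edges :: "'a graph \<Rightarrow> 'a set set" where
  "edges G \<equiv> snd G"

definition simple_graph :: "'a graph \<Rightarrow> bool" where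
  "simple_graph G \<longleftrightarrow> finite (verts G) \<and> (\<forall>e\<in>edges G. e \<subseteq> verts G \<and> card e = 2)"

definition spanning_subgraph :: "'a graph \<Rightarrow> 'a graph \<Rightarrow> bool" where
  "spanning_subgraph H G \<longleftrightarrow> simple_graph H \<and> verts H = verts G \<and> edges H \<subseteq> edges G"

definition add_edge :: "'a graph \<Rightarrow> 'a set \<Rightarrow> 'a graph" where
  "add_edge H e = (verts H, insert e (edges H))"

text \<open>A copy of F in H is a not necessarily induced subgraph of H isomorphic to F.\<close>

definition contains_copy :: "'a graph \<Rightarrow> 'b graph \<Rightarrow> bool" where
  "contains_copy H F \<longleftrightarrow>
    (\<exists>f. inj_on f (verts F) \<and> f ` verts F \<subseteq> verts H \<and> (\<forall>e\<in>edges F. f ` e \<in> edges H))"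

definition saturated :: "'a graph \<Rightarrow> 'b graph \<Rightarrow> 'a graph \<Rightarrow> bool" where
  "saturated G F H \<longleftrightarrow>
    spanning_subgraph H G \<and> \<not> contains_copy H F \<and>
    (\<forall>e \<in> edges G - edges H. contains_copy (add_edge H e) F)"

text \<open>The infimum is over natural numbers, so it is attained as soon as a saturated graph exists;
  it is 0 if there is none.\<close>

definition sat :: "'a graph \<Rightarrow> 'b graph \<Rightarrow> nat" where
  "sat G F = Inf {card (edges H) | H. saturated G F H}"

text \<open>The pair (i, a) is the a-th vertex of the i-th part.\<close>

definition complete_multipartite :: "nat \<Rightarrow> nat \<Rightarrow> (nat \<times> nat) graph" where
  "complete_multipartite k n =
    ({..<k} \<times> {..<n},
     {{(i, a), (j, b)} | i a j b. i < k \<and> j < k \<and> i \<noteq> j \<and> a < n \<and> b < n})"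

text \<open>This is the cycle on m vertices only for m at least 3.\<close>

definition cycle_graph :: "nat \<Rightarrow> nat graph" where
  "cycle_graph m = ({..<m}, {{i, Suc i mod m} | i. i < m})"

lemma simple_graph_complete_multipartite: "simple_graph (complete_multipartite k n)"
  by (auto simp: simple_graph_def complete_multipartite_def)

lemma simple_graph_cycle_graph:
  assumes "m \<ge> 3"
  shows "simple_graph (cycle_graph m)"
proof -
  have "i \<noteq> Suc i mod m" if "i < m" for i
    using that assms by (cases "Suc i = m") auto
  then show ?thesis
    using assms by (auto simp: simple_graph_def cycle_graph_def)
qed

end

theory Submission
  imports Defs
begin

text \<open>
Upper bound: take a \<open>K\<^sub>4\<close> on one vertex of each part and hang every other vertex as a leaf, the
leaves of part \<open>i\<close> all at the core vertex of part \<open>i + 1\<close> modulo 4.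

Lower bound: suppose a saturated graph on \<open>N\<close> vertices has at most \<open>N + 1\<close> edges. It is connected,
so a breadth-first tree misses at most two edges; call their at most four endpoints marked. A
non-leaf without marked descendants is a stem, that is, all its neighbours but its parent are
leaves. Saturation puts every other edge at the parent of a stem on a triangle or a 4-cycle, so
distinct stems have distinct parents, and these have marked descendants. A part
without leaves would therefore embed into marked vertices times \<open>bool\<close>, up to one vertex, hence have
at most nine vertices. So every part has a leaf. Paths of length 4 from
leaves then produce a triangle at a vertex carrying a leaf, and hence a diamond (\<open>K\<^sub>4\<close> minus an
edge). The diamond already has one more edge than vertices, so all the rest is a forest hanging from
it and the two tips of the diamond are non-adjacent, hence in one part. A leaf in that part hangs at
a child of a tip, which forces the leaves of the other three parts to hang at the two spine
vertices; but leaves of different parts never share their neighbour.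
\<close>

section \<open>Finite graphs, leaves and stems\<close>

locale fin_graph =
  fixes V :: "'a set" and E :: "'a set set"
  assumes finV: "finite V"
    and edgeE: "e \<in> E \<Longrightarrow> \<exists>u v. e = {u, v} \<and> u \<noteq> v \<and> u \<in> V \<and> v \<in> V"
begin

definition adj :: "'a \<Rightarrow> 'a \<Rightarrow> bool" where
  "adj u v \<longleftrightarrow> {u, v} \<in> E"

definition leaf_at :: "'a \<Rightarrow> 'a \<Rightarrow> bool" where
  "leaf_at l x \<longleftrightarrow> adj l x \<and> (\<forall>z. adj l z \<longrightarrow> z = x)"

lemma adj_sym: "adj u v \<longleftrightarrow> adj v u"
  by (simp add: adj_def insert_commute)

lemma adj_irrefl: "\<not> adj u u"
proof
  assume "adj u u"
  then have "{u, u} \<in> E"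
    by (simp add: adj_def)
  then obtain a b where "{u, u} = {a, b}" "a \<noteq> b"
    using edgeE by blast
  then show False
    by (auto simp: doubleton_eq_iff)
qed

lemma adjV: assumes "adj u v" shows "u \<in> V" "v \<in> V"
proof -
  obtain a b where "{u, v} = {a, b}" "a \<in> V" "b \<in> V"
    using assms edgeE[of "{u, v}"] by (auto simp: adj_def)
  then show "u \<in> V" "v \<in> V"
    by auto
qed

lemma finE: "finite E"
proof (rule finite_subset)
  show "E \<subseteq> Pow V"
    using edgeE by blast
qed (simp add: finV)

lemma leaf_atD: "leaf_at l x \<Longrightarrow> adj l z \<Longrightarrow> z = x" "leaf_at l x \<Longrightarrow> adj z l \<Longrightarrow> z = x"
  by (auto simp: leaf_at_def adj_sym)

lemma leaf_at_adj: "leaf_at l x \<Longrightarrow> adj l x"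
  by (simp add: leaf_at_def)

text \<open>Meant for adjacent \<open>y\<close> and \<open>z\<close>: their edge lies on a triangle or on a 4-cycle.\<close>
definition short_cycle :: "'a \<Rightarrow> 'a \<Rightarrow> bool" where
  "short_cycle y z \<longleftrightarrow> (\<exists>r. adj y r \<and> adj r z) \<or>
     (\<exists>a b. adj y a \<and> adj a b \<and> adj b z \<and> a \<noteq> z \<and> b \<noteq> y)"

lemma short_cycle_sym: "short_cycle y z \<Longrightarrow> short_cycle z y"
  unfolding short_cycle_def by (metis adj_sym)

text \<open>The leaf other than \<open>y\<close> keeps a leaf hanging at \<open>y\<close> from
  counting as a stem; it is also where the paths of length 4 start.\<close>

definition stem :: "'a \<Rightarrow> 'a \<Rightarrow> bool" where
  "stem s y \<longleftrightarrow> adj s y \<and> (\<exists>l. leaf_at l s \<and> l \<noteq> y) \<and> (\<forall>z. adj s z \<longrightarrow> z = y \<or> leaf_at z s)"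

end

section \<open>Breadth-first layerings, marked and free vertices\<close>

text \<open>The levels are the distances from \<open>S\<close>, and \<open>par\<close> is the parent map of a breadth-first
  search from \<open>S\<close>. The vertices of \<open>S\<close> are their own parents.\<close>
locale layering = fin_graph +
  fixes S :: "'a set" and lev :: "'a \<Rightarrow> nat" and par :: "'a \<Rightarrow> 'a"
  assumes SV: "S \<subseteq> V"
    and lev_S: "v \<in> S \<Longrightarrow> lev v = 0"
    and par_S: "v \<in> S \<Longrightarrow> par v = v"
    and adj_par: "v \<in> V \<Longrightarrow> v \<notin> S \<Longrightarrow> adj v (par v)"
    and lev_par: "v \<in> V \<Longrightarrow> v \<notin> S \<Longrightarrow> lev v = Suc (lev (par v))"
    and lev_adj: "adj u v \<Longrightarrow> lev v \<le> Suc (lev u)"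
begin

definition inner :: "'a set set" where
  "inner = {e \<in> E. e \<subseteq> S}"

definition tree :: "'a set set" where
  "tree = (\<lambda>v. {v, par v}) ` (V - S)"

definition extra :: "'a set set" where
  "extra = E - inner - tree"

lemma tree_subset: "tree \<subseteq> E"
  using adj_par by (auto simp: tree_def adj_def)

lemma card_tree: "card tree = card (V - S)"
  unfolding tree_def
proof (rule card_image, rule inj_onI)
  fix v w
  assume "v \<in> V - S" "w \<in> V - S" "{v, par v} = {w, par w}"
  then show "v = w"
    using lev_par[of v] lev_par[of w] by (auto simp: doubleton_eq_iff)
qed

text \<open>The three classes are disjoint, and each vertex outside \<open>S\<close> owns exactly
  one tree edge, the one to its parent.\<close>

lemma card_edges: "card E = card inner + card (V - S) + card extra"
proof -
  have disj: "inner \<inter> tree = {}"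
    by (auto simp: inner_def tree_def)
  have sub: "inner \<union> tree \<subseteq> E"
    using tree_subset by (auto simp: inner_def)
  have fin: "finite inner" "finite tree" "finite (inner \<union> tree)"
    using sub finE finite_subset by auto
  have "card (inner \<union> tree) = card inner + card tree"
    using disj fin by (simp add: card_Un_disjoint)
  moreover have "card extra = card E - card (inner \<union> tree)"
    using card_Diff_subset[OF fin(3) sub] by (simp add: extra_def Diff_eq Int_assoc)
  moreover have "card (inner \<union> tree) \<le> card E"
    using sub finE card_mono by blast
  ultimately show ?thesis
    using card_tree by simp
qed

definition marked :: "'a set" where
  "marked = \<Union> extra"

lemma finite_marked: "finite marked"
  unfolding marked_def
proof (rule finite_Union)
  show "finite extra"
    using finE by (simp add: extra_def)
  fix e assume "e \<in> extra"
  then show "finite e"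
    using edgeE[of e] by (auto simp: extra_def)
qed

lemma card_marked: "card marked \<le> 2 * card extra"
proof -
  have "card marked \<le> sum card extra"
    unfolding marked_def by (rule card_Union_le_sum_card)
  also have "\<dots> \<le> sum (\<lambda>_. 2) extra"
  proof (rule sum_mono)
    fix e assume "e \<in> extra"
    then show "card e \<le> 2"
      using edgeE[of e] by (auto simp: extra_def)
  qed
  finally show ?thesis
    by simp
qed

lemma edge_cases:
  assumes "adj u v" "u \<notin> marked"
  shows "(u \<in> S \<and> v \<in> S) \<or> (u \<notin> S \<and> v = par u) \<or> (v \<notin> S \<and> u = par v)"
proof -
  have "{u, v} \<notin> extra"
    using assms(2) by (auto simp: marked_def)
  then have "{u, v} \<in> inner \<or> {u, v} \<in> tree"
    using assms(1) by (auto simp: extra_def adj_def)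
  then show ?thesis
    by (auto simp: inner_def tree_def doubleton_eq_iff)
qed

lemma par_in_V: "v \<in> V \<Longrightarrow> par v \<in> V"
  using par_S adj_par adjV by (metis)

lemma lev_pos: "v \<in> V \<Longrightarrow> v \<notin> S \<Longrightarrow> 0 < lev v"
  using lev_par by simp

lemma par_pow_in_V: "d \<in> V \<Longrightarrow> (par ^^ k) d \<in> V"
  by (induction k) (auto simp: par_in_V)

text \<open>Truncated subtraction is right here: once the iteration reaches \<open>S\<close> it
  stays there, at level 0.\<close>

lemma lev_par_pow: "d \<in> V \<Longrightarrow> lev ((par ^^ k) d) = lev d - k"
proof (induction k)
  case (Suc k)
  then show ?case
    using lev_par[of "(par ^^ k) d"] par_pow_in_V[of d k] par_S[of "(par ^^ k) d"] lev_S
    by (cases "(par ^^ k) d \<in> S") (auto simp: diff_Suc split: nat.splits)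
qed simp

definition anc :: "'a \<Rightarrow> 'a \<Rightarrow> bool" where
  "anc w d \<longleftrightarrow> (\<exists>k. (par ^^ k) d = w)"

lemma anc_refl: "anc d d"
  unfolding anc_def by (rule exI[of _ 0]) simp

lemma anc_par: "anc w d \<Longrightarrow> anc (par w) d"
  unfolding anc_def by (metis funpow.simps(2) comp_apply)

text \<open>A positive level determines the number of parent steps taken from
  \<open>d\<close>.\<close>

lemma anc_unique:
  assumes "d \<in> V" "anc w d" "anc w' d" "0 < lev w" "lev w = lev w'"
  shows "w = w'"
proof -
  obtain k k' where k: "w = (par ^^ k) d" "w' = (par ^^ k') d"
    using assms by (auto simp: anc_def)
  then have "k = k'"
    using assms lev_par_pow[of d k] lev_par_pow[of d k'] by auto
  then show ?thesis
    using k by simp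
qed

lemma marked_V: "marked \<subseteq> V"
  using edgeE by (fastforce simp: marked_def extra_def)

definition free :: "'a \<Rightarrow> bool" where
  "free w \<longleftrightarrow> (\<forall>d\<in>marked. \<not> anc w d)"

lemma free_unmarked: "free w \<Longrightarrow> w \<notin> marked"
  using anc_refl by (auto simp: free_def)

lemma free_child: "free (par w) \<Longrightarrow> free w"
  using anc_par by (auto simp: free_def)

text \<open>An unmarked vertex meets only parent edges and edges inside \<open>S\<close>, so here
  every neighbour but the parent is a child. Freeness passes on to it, and the argument can be
  repeated further down.\<close>

lemma free_nbr:
  assumes "free w" "w \<notin> S" "adj w z" "z \<noteq> par w"
  shows "z \<notin> S" "par z = w" "free z" "lev z = Suc (lev w)"
proof -
  show z: "z \<notin> S" "par z = w"
    using edge_cases[OF assms(3)] free_unmarked assms by auto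
  show "free z"
    using free_child assms(1) z(2) by auto
  show "lev z = Suc (lev w)"
    using lev_par[of z] z adjV assms(3) by auto
qed

text \<open>A walk leaving \<open>w\<close> away from its parent can only descend: its next two
  vertices lie one and two levels deeper than \<open>w\<close>, whereas neighbours of
  \<open>par w\<close> are at most as deep as \<open>w\<close>.\<close>

lemma free_no_short_cycle:
  assumes "free w" "w \<in> V" "w \<notin> S"
  shows "\<not> short_cycle w (par w)"
proof
  assume "short_cycle w (par w)"
  then consider r where "adj w r" "adj r (par w)"
    | a b where "adj w a" "adj a b" "adj b (par w)" "a \<noteq> par w" "b \<noteq> w"
    by (auto simp: short_cycle_def)
  then show False
  proof cases
    case 1
    then have "r \<noteq> par w"
      using adj_irrefl by auto
    then have "lev r = Suc (lev w)"
      using free_nbr(4) assms 1 by auto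
    then show False
      using lev_adj[of "par w" r] 1(2) lev_par[OF assms(2,3)] adj_sym by auto
  next
    case 2
    have a: "a \<notin> S" "par a = w" "free a" "lev a = Suc (lev w)"
      using free_nbr[OF assms(1,3) 2(1,4)] by auto
    then have "lev b = Suc (lev a)"
      using free_nbr(4)[OF a(3,1) 2(2)] 2(5) by auto
    then show False
      using lev_adj[of "par w" b] 2(3) lev_par[OF assms(2,3)] adj_sym a by auto
  qed
qed

end

section \<open>Consequences of saturation: connectedness, short cycles at stems, diamonds\<close>

locale C5_saturated = fin_graph +
  fixes c :: "'a \<Rightarrow> nat"
  assumes proper: "adj u v \<Longrightarrow> c u \<noteq> c v"
    and no_C5: "adj v\<^sub>1 v\<^sub>2 \<Longrightarrow> adj v\<^sub>2 v\<^sub>3 \<Longrightarrow> adj v\<^sub>3 v\<^sub>4 \<Longrightarrow> adj v\<^sub>4 v\<^sub>5 \<Longrightarrow> adj v\<^sub>5 v\<^sub>1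
        \<Longrightarrow> \<not> distinct [v\<^sub>1, v\<^sub>2, v\<^sub>3, v\<^sub>4, v\<^sub>5]"
    and path4: "u \<in> V \<Longrightarrow> v \<in> V \<Longrightarrow> c u \<noteq> c v \<Longrightarrow> \<not> adj u v \<Longrightarrow>
        \<exists>x y z. adj u x \<and> adj x y \<and> adj y z \<and> adj z v \<and> distinct [u, x, y, z, v]"
    and colour_less: "v \<in> V \<Longrightarrow> c v < 4"
    and big_part: "i < 4 \<Longrightarrow> 10 \<le> card {v \<in> V. c v = i}"
begin

lemma colour_exists: "i < 4 \<Longrightarrow> \<exists>v\<in>V. c v = i"
  using big_part[of i] by (metis (mono_tags, lifting) card.empty empty_Collect_eq not_numeral_le_zero)

definition arcs :: "('a \<times> 'a) set" where
  "arcs = {(u, v). adj u v}"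

lemma connected_diff:
  assumes "u \<in> V" "v \<in> V" "c u \<noteq> c v"
  shows "(u, v) \<in> arcs\<^sup>*"
proof (cases "adj u v")
  case True
  then show ?thesis
    by (auto simp: arcs_def)
next
  case False
  then obtain x y z where "adj u x" "adj x y" "adj y z" "adj z v"
    using path4 assms by blast
  then have "(u, x) \<in> arcs" "(x, y) \<in> arcs" "(y, z) \<in> arcs" "(z, v) \<in> arcs"
    by (auto simp: arcs_def)
  then show ?thesis
    by (meson converse_rtrancl_into_rtrancl rtrancl.rtrancl_refl)
qed

text \<open>Two vertices of one part are joined through a vertex of another part.\<close>

lemma connected:
  assumes "u \<in> V" "v \<in> V"
  shows "(u, v) \<in> arcs\<^sup>*"
proof (cases "c u = c v")
  case True
  have "(if c u = 0 then 1 else 0) < (4 :: nat)" "(if c u = 0 then 1 else 0) \<noteq> c u"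
    by auto
  then obtain w where "w \<in> V" "c w \<noteq> c u"
    using colour_exists by metis
  then show ?thesis
    using True assms connected_diff[of u w] connected_diff[of w v] by (metis rtrancl_trans)
qed (simp add: assms connected_diff)

text \<open>The level is the least length of a walk from \<open>S\<close>. The last vertex before
  \<open>v\<close> on a shortest walk shows that \<open>v\<close> has a neighbour one level closer,
  and any such neighbour may serve as parent.\<close>

lemma layering_exists:
  assumes "S \<subseteq> V" "S \<noteq> {}"
  obtains lev par where "layering V E S lev par"
proof -
  define lev where "lev v = (LEAST k. \<exists>s\<in>S. (s, v) \<in> arcs ^^ k)" for v
  have reach: "\<exists>k. \<exists>s\<in>S. (s, v) \<in> arcs ^^ k" if "v \<in> V" for v
    using assms connected that by (metis all_not_in_conv rtrancl_imp_relpow subsetD)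
  have lev_in: "\<exists>s\<in>S. (s, v) \<in> arcs ^^ lev v" if "v \<in> V" for v
    unfolding lev_def using LeastI_ex[OF reach[OF that]] .
  have lev_le: "lev v \<le> k" if "s \<in> S" "(s, v) \<in> arcs ^^ k" for v s k
    unfolding lev_def using that by (auto intro: Least_le)
  have lev0: "lev v = 0" if "v \<in> S" for v
    using lev_le[OF that, of v 0] by simp
  have step: "lev v \<le> Suc (lev u)" if uv: "adj u v" for u v
  proof -
    obtain s where "s \<in> S" "(s, u) \<in> arcs ^^ lev u"
      using lev_in adjV uv by blast
    then show ?thesis
      using uv by (intro lev_le[of s]) (auto simp: arcs_def)
  qed
  have ex: "\<exists>u. adj v u \<and> lev v = Suc (lev u)" if v: "v \<in> V" "v \<notin> S" for v
  proof -
    obtain s where s: "s \<in> S" "(s, v) \<in> arcs ^^ lev v"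
      using lev_in v by blast
    then obtain m where m: "lev v = Suc m"
      using v by (cases "lev v") auto
    then obtain u where u: "(s, u) \<in> arcs ^^ m" "(u, v) \<in> arcs"
      using s by auto
    then have "lev u \<le> m" "adj u v"
      using lev_le s by (auto simp: arcs_def)
    then have "adj v u \<and> lev v = Suc (lev u)"
      using step[of u v] m adj_sym by auto
    then show ?thesis ..
  qed
  define par where "par v = (if v \<in> S then v else SOME u. adj v u \<and> lev v = Suc (lev u))" for v
  have par: "adj v (par v) \<and> lev v = Suc (lev (par v))" if "v \<in> V" "v \<notin> S" for v
    using someI_ex[OF ex[OF that]] that by (simp add: par_def)
  have "layering V E S lev par"
    by unfold_locales (use assms lev0 step par in \<open>auto simp: par_def\<close>)
  then show ?thesis
    by (rule that)
qed

text \<open>A path of length 4 from a leaf \<open>l\<close> of the stem to \<open>z\<close> has to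
  pass \<open>s\<close> and \<open>y\<close>, so it closes a triangle on the edge from
  \<open>y\<close> to \<open>z\<close>. If \<open>l\<close> and \<open>z\<close> share a part, then
  \<open>s\<close> and \<open>z\<close> do not, and the path from \<open>s\<close> to
  \<open>z\<close> through \<open>y\<close> closes a 4-cycle.\<close>

lemma stem_short_cycle:
  assumes "stem s y" "adj y z" "z \<noteq> s"
  shows "short_cycle y z"
proof -
  obtain l where l: "leaf_at l s" "l \<noteq> y"
    using assms by (auto simp: stem_def)
  have sy: "adj s y" "\<And>z. adj s z \<Longrightarrow> z = y \<or> leaf_at z s"
    using assms by (auto simp: stem_def)
  have V: "l \<in> V" "s \<in> V" "z \<in> V"
    using adjV leaf_at_adj l assms(2) by blast+
  show ?thesis
  proof (cases "c z = c l")
    case False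
    then have "\<not> adj l z"
      using l assms(3) leaf_atD by blast
    then obtain p q r where "adj l p" "adj p q" "adj q r" "adj r z" "distinct [l, p, q, r, z]"
      using path4[of l z] V False by auto
    moreover have "p = s"
      using leaf_atD l calculation by blast
    moreover have "q = y"
      using sy(2)[of q] leaf_atD[of q s r] calculation by auto
    ultimately show ?thesis
      by (auto simp: short_cycle_def)
  next
    case True
    then have "c s \<noteq> c z"
      using proper[OF leaf_at_adj[OF l(1)]] by simp
    moreover have "\<not> adj s z"
      using sy(2)[of z] assms(2) leaf_atD(2)[of z s y] adj_irrefl sy(1) by metis
    ultimately obtain p q r where "adj s p" "adj p q" "adj q r" "adj r z" "distinct [s, p, q, r, z]"
      using path4[of s z] V by auto
    moreover have "p = y"
      using sy(2)[of p] leaf_atD[of p s q] calculation by auto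
    ultimately show ?thesis
      by (auto simp: short_cycle_def)
  qed
qed

text \<open>A short cycle on the edge from \<open>y\<close> to \<open>s'\<close> would have to leave
  \<open>s'\<close> through a leaf.\<close>

lemma stem_unique:
  assumes "stem s y" "stem s' y"
  shows "s = s'"
proof (rule ccontr)
  assume "s \<noteq> s'"
  have sy: "adj s' y" "\<And>z. adj s' z \<Longrightarrow> z = y \<or> leaf_at z s'"
    using assms by (auto simp: stem_def)
  have "short_cycle y s'"
    using stem_short_cycle[OF assms(1), of s'] sy \<open>s \<noteq> s'\<close> adj_sym by blast
  then show False
    unfolding short_cycle_def using sy leaf_atD adj_sym adj_irrefl by metis
qed

text \<open>A path of length 4 between two leaves at \<open>x\<close> would have to visit
  \<open>x\<close> twice.\<close>

lemma leaf_same_parent: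
  assumes "leaf_at l x" "leaf_at l' x"
  shows "c l = c l'"
proof (rule ccontr)
  assume "c l \<noteq> c l'"
  moreover have "\<not> adj l l'"
    using assms leaf_atD adj_irrefl leaf_at_adj by metis
  ultimately obtain p q r where "adj l p" "adj p q" "adj q r" "adj r l'" "distinct [l, p, q, r, l']"
    using path4[of l l'] assms leaf_at_adj adjV by metis
  moreover have "p = x" "r = x"
    using leaf_atD assms calculation by blast+
  ultimately show False
    by auto
qed

text \<open>The tips are \<open>p\<close> and \<open>q\<close>, the spine is the edge from
  \<open>r\<close> to \<open>s\<close>. Whether the tips are adjacent is left open.\<close>

definition diamond :: "'a \<Rightarrow> 'a \<Rightarrow> 'a \<Rightarrow> 'a \<Rightarrow> bool" where
  "diamond p q r s \<longleftrightarrow> distinct [p, q, r, s] \<and> adj p r \<and> adj p s \<and> adj q r \<and> adj q s \<and> adj r s"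

lemma leaf_path4:
  assumes "leaf_at l x" "c l \<noteq> c v" "v \<in> V" "v \<noteq> x"
  obtains a b where "adj x a" "adj a b" "adj b v" "distinct [l, x, a, b, v]"
proof -
  have "\<not> adj l v"
    using assms leaf_atD by blast
  then obtain p q r where "adj l p" "adj p q" "adj q r" "adj r v" "distinct [l, p, q, r, v]"
    using path4[of l v] assms leaf_at_adj adjV by metis
  moreover have "p = x"
    using leaf_atD assms calculation by blast
  ultimately show ?thesis
    using that by blast
qed

text \<open>The path of length 4 from \<open>l\<close> to \<open>a\<close>, closed up through
  \<open>b\<close> instead of \<open>l\<close>, would be a 5-cycle unless it already passes
  \<open>b\<close>. Either position of \<open>b\<close> on it gives a second triangle sharing an
  edge with the first.\<close>

lemma leaf_triangle_diamond_aux: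
  assumes "leaf_at l x" "adj x a" "adj a b" "adj b x" "c l \<noteq> c a"
  shows "\<exists>p q r s. diamond p q r s"
proof -
  have d: "x \<noteq> a" "a \<noteq> b" "b \<noteq> x"
    using assms adj_irrefl by auto
  obtain p q where pq: "adj x p" "adj p q" "adj q a" "distinct [l, x, p, q, a]"
    using leaf_path4[OF assms(1,5)] adjV assms(2) d by metis
  have "b = p \<or> b = q"
    using no_C5[of x p q a b] pq assms d by auto
  then show ?thesis
  proof
    assume "b = p"
    then have "diamond x q a b"
      using pq assms d adj_sym by (auto simp: diamond_def)
    then show ?thesis
      by blast
  next
    assume "b = q"
    then have "diamond a p x b"
      using pq assms d adj_sym by (auto simp: diamond_def)
    then show ?thesis
      by blast
  qed
qed

text \<open>Being adjacent, \<open>a\<close> and \<open>b\<close> are not both in the part of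
  \<open>l\<close>.\<close>

lemma leaf_triangle_diamond:
  assumes "leaf_at l x" "adj x a" "adj a b" "adj b x"
  shows "\<exists>p q r s. diamond p q r s"
proof (cases "c l = c a")
  case False
  then show ?thesis
    using leaf_triangle_diamond_aux assms by blast
next
  case True
  then have "c l \<noteq> c b"
    using proper assms(3) by simp
  then show ?thesis
    using leaf_triangle_diamond_aux[of l x b a] assms adj_sym by blast
qed

text \<open>Take leaves \<open>l\<close> at \<open>x\<close> and \<open>l'\<close> at
  \<open>x'\<close> with \<open>l'\<close> neither in the part of \<open>l\<close> nor in that of
  \<open>x\<close>. The path from \<open>l\<close> to \<open>l'\<close> contains a path of length 2
  from \<open>x\<close> to \<open>x'\<close>, the path from \<open>l'\<close> to \<open>x\<close>
  one of length 3. Together they form no 5-cycle, so they share an inner vertex, which makes a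
  triangle at \<open>x\<close> or at \<open>x'\<close>.\<close>

lemma diamond_exists:
  assumes leaf: "\<And>i. i < 4 \<Longrightarrow> \<exists>l x. leaf_at l x \<and> c l = i"
  shows "\<exists>p q r s. diamond p q r s"
proof -
  obtain l x where l: "leaf_at l x"
    using leaf[of 0] by auto
  have "\<exists>i<4. i \<noteq> c l \<and> i \<noteq> c x"
  proof -
    have "\<not> {..<4} \<subseteq> {c l, c x}"
    proof
      assume "{..<4} \<subseteq> {c l, c x}"
      then have "card {..<4::nat} \<le> card {c l, c x}"
        by (intro card_mono) auto
      then show False
        using card_insert_le_m1[of 2 "{c x}" "c l"] by simp
    qed
    then show ?thesis
      by auto
  qed
  then obtain i where i: "i < 4" "i \<noteq> c l" "i \<noteq> c x"
    by blast
  then obtain l' x' where l': "leaf_at l' x'" "c l' = i"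
    using leaf by blast
  have xx: "x \<noteq> x'"
    using leaf_same_parent[OF l, of l'] l' i by metis
  have V: "l' \<in> V" "x \<in> V"
    using adjV[OF leaf_at_adj[OF l]] adjV[OF leaf_at_adj[OF l'(1)]] by auto
  obtain p where p: "adj x p" "adj p x'" "distinct [l, x, p, x', l']"
  proof -
    have "l' \<noteq> x"
      using i l' by auto
    then obtain a b where "adj x a" "adj a b" "adj b l'" "distinct [l, x, a, b, l']"
      using leaf_path4[OF l, of l'] V i l' by auto
    moreover have "b = x'"
      using calculation l' leaf_atD by blast
    ultimately show ?thesis
      using that by blast
  qed
  obtain a b where ab: "adj x' a" "adj a b" "adj b x" "distinct [l', x', a, b, x]"
    using leaf_path4[OF l'(1), of x] V i l' xx by auto
  have "p = a \<or> p = b"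
    using no_C5[of x p x' a b] p ab by auto
  then show ?thesis
  proof
    assume "p = a"
    then show ?thesis
      using leaf_triangle_diamond[OF l p(1), of b] ab by auto
  next
    assume "p = b"
    then show ?thesis
      using leaf_triangle_diamond[OF l'(1) ab(1), of p] ab p by auto
  qed
qed

end

section \<open>Counting a part by means of marked descendants\<close>

lemma card_le_8:
  assumes "finite M" "card M \<le> 4" "inj_on f A" "f ` A \<subseteq> M \<times> (UNIV :: bool set)"
  shows "card A \<le> 8"
proof -
  have "card A \<le> card (M \<times> (UNIV :: bool set))"
    using assms by (intro card_inj_on_le) auto
  then show ?thesis
    using assms by (simp add: card_cartesian_product)
qed

locale layered_C5 = C5_saturated V E c + layering V E S lev par
  for V :: "'a set" and E c S lev par
begin

text \<open>Induction from the deepest level upwards. A child that is not a leaf would be a stem at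
  \<open>w\<close>, which puts the edge from \<open>w\<close> to its parent on a short cycle,
  impossible for free \<open>w\<close>.\<close>

lemma free_stem:
  assumes "S = {v}" "w \<in> V" "w \<notin> S" "free w" "\<not> leaf_at w (par w)"
  shows "stem w (par w)"
  using assms(2-)
proof (induction "Max (lev ` V) - lev w" arbitrary: w rule: less_induct)
  case less
  have kid: "leaf_at z w" if z: "adj w z" "z \<noteq> par w" for z
  proof (rule ccontr)
    assume nl: "\<not> leaf_at z w"
    have zz: "z \<notin> S" "par z = w" "free z" "lev z = Suc (lev w)"
      using free_nbr[OF less.prems(3,2) z] by auto
    have zV: "z \<in> V"
      using adjV z by blast
    have "lev z \<le> Max (lev ` V)"
      using zV finV by simp
    then have "stem z (par z)"
      using less.hyps[of z] zz zV nl by simp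
    then have "short_cycle w (par w)"
      using stem_short_cycle[of z w "par w"] zz z adj_par less.prems by auto
    then show False
      using free_no_short_cycle less.prems by auto
  qed
  have "adj w (par w)"
    using adj_par less.prems by blast
  moreover obtain z where "adj w z" "z \<noteq> par w"
    using less.prems(4) calculation by (auto simp: leaf_at_def)
  ultimately show ?case
    unfolding stem_def using kid by blast
qed

text \<open>With a single root the tree has \<open>card V - 1\<close> edges, so at most two extra
  edges remain, with two ends each.\<close>

lemma card_marked_le:
  assumes "S = {v}" "card E \<le> card V + 1"
  shows "card marked \<le> 4"
proof -
  have "v \<in> V"
    using assms SV by auto
  then have "card (V - S) = card V - 1" "card V \<ge> 1"
    using assms finV by (auto simp: Suc_le_eq card_gt_0_iff)
  then have "card extra \<le> 2"
    using card_edges assms(2) by linarith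
  then show ?thesis
    using card_marked by linarith
qed

text \<open>On consecutive levels one ancestor would be the parent of the other, hence in a
  different part.\<close>

lemma part_anc_unique:
  assumes "d \<in> V" "anc w d" "anc w' d" "w \<in> V" "w' \<in> V" "w \<notin> S" "w' \<notin> S" "c w = c w'"
    "lev w \<le> Suc (lev w')" "lev w' \<le> Suc (lev w)"
  shows "w = w'"
proof -
  have adj: False if w: "u \<in> V" "u \<notin> S" "anc u d" "anc u' d" "u' \<in> V" "u' \<notin> S" "c u = c u'"
    "lev u = Suc (lev u')" for u u'
  proof -
    have "lev (par u) = lev u'" "anc (par u) d"
      using w lev_par[of u] anc_par by auto
    then have "par u = u'"
      using anc_unique[of d "par u" u'] w assms(1) lev_pos[of u'] by auto
    then show False
      using proper adj_par w by metis
  qed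
  have "lev w = lev w' \<or> lev w = Suc (lev w') \<or> lev w' = Suc (lev w)"
    using assms by linarith
  then show ?thesis
    using adj[of w w'] adj[of w' w] anc_unique[of d w w'] lev_pos assms by metis
qed

text \<open>The path of length 4 from a leaf of \<open>s\<close> to \<open>w\<close> has to pass
  \<open>s\<close> and then the root \<open>y\<close>.\<close>

lemma stem_level_le_2:
  assumes "S = {y}" "stem s y" "w \<in> V" "c w = c s" "w \<noteq> s"
  shows "lev w \<le> 2"
proof -
  obtain l where l: "leaf_at l s"
    using assms(2) by (auto simp: stem_def)
  have "c l \<noteq> c w"
    using proper[OF leaf_at_adj[OF l]] assms(4) by simp
  then obtain a b where ab: "adj s a" "adj a b" "adj b w" "distinct [l, s, a, b, w]"
    using leaf_path4[OF l] assms(3,5) by metis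
  have "a = y"
    using assms(2) ab leaf_atD(1)[of a s b] unfolding stem_def by auto
  then have "lev a = 0"
    using lev_S assms(1) by simp
  then show ?thesis
    using lev_adj[OF ab(2)] lev_adj[OF ab(3)] by simp
qed

text \<open>Suppose the part of \<open>s\<close> has no leaf. Charge every other vertex of it to a
  marked vertex: a non-free one to a marked descendant of itself, a free one to a marked descendant
  of its parent. Together with a flag for the case this is injective, so at most 8 vertices are
  charged, but there are at least 9.\<close>

lemma stem_imp_leaf:
  assumes "S = {y}" "card E \<le> card V + 1" "stem s y"
  shows "\<exists>l x. leaf_at l x \<and> c l = c s"
proof (rule ccontr)
  assume no: "\<not> (\<exists>l x. leaf_at l x \<and> c l = c s)"
  define A where "A = {w \<in> V. c w = c s} - {s}"
  have sy: "adj s y"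
    using assms(3) by (simp add: stem_def)
  have sV: "s \<in> V" "c s < 4"
    using adjV[OF sy] colour_less by auto
  have A: "w \<in> V" "w \<notin> S" "c w = c s" "w \<noteq> s" "lev w \<le> 2" "0 < lev w" if "w \<in> A" for w
  proof -
    show w: "w \<in> V" "c w = c s" "w \<noteq> s"
      using that by (auto simp: A_def)
    show "w \<notin> S"
      using w proper[OF sy] assms(1) by auto
    then show "0 < lev w"
      using w lev_pos by blast
    show "lev w \<le> 2"
      using stem_level_le_2 assms w by blast
  qed
  have free: "stem w (par w)" "lev (par w) = 1" "\<not> free (par w)" if w: "w \<in> A" "free w" for w
  proof -
    have wV: "w \<in> V" "w \<notin> S"
      using A w by auto
    show st: "stem w (par w)"
      using free_stem[OF assms(1) wV w(2)] no A(3)[OF w(1)] by blast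
    \<comment> \<open>Otherwise \<open>w\<close> and \<open>s\<close> would be two stems at the
      root.\<close>
    have ny: "par w \<noteq> y"
      using stem_unique[of w y s] st assms(3) A(4)[OF w(1)] by auto
    then have pS: "par w \<notin> S" "par w \<in> V"
      using assms(1) par_in_V wV by auto
    show lev1: "lev (par w) = 1"
      using lev_par[OF wV] A(5)[OF w(1)] lev_pos[OF pS(2,1)] by simp
    have "lev (par (par w)) = 0"
      using lev_par[OF pS(2,1)] lev1 by simp
    then have ppw: "par (par w) = y"
      using lev_pos[of "par (par w)"] par_in_V pS assms(1) by auto
    then have yp: "adj y (par w)"
      using adj_par[OF pS(2,1)] adj_sym by simp
    have "par w \<noteq> s"
      using proper[OF adj_par[OF wV]] A(3)[OF w(1)] by auto
    \<comment> \<open>The stem \<open>s\<close> hangs at the root as well, so it forces a short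
      cycle on the edge from the root to \<open>par w\<close>; a free \<open>par w\<close> would
      exclude that.\<close>
    then have "short_cycle (par w) (par (par w))"
      using stem_short_cycle[OF assms(3) yp] short_cycle_sym ppw by simp
    then show "\<not> free (par w)"
      using free_no_short_cycle pS by blast
  qed
  have "\<exists>d\<in>marked. (free w \<longrightarrow> anc (par w) d) \<and> (\<not> free w \<longrightarrow> anc w d)" if "w \<in> A" for w
    using free(3)[OF that] by (cases "free w") (auto simp: free_def)
  then obtain g where g: "\<And>w. w \<in> A \<Longrightarrow> g w \<in> marked"
    "\<And>w. w \<in> A \<Longrightarrow> free w \<Longrightarrow> anc (par w) (g w)"
    "\<And>w. w \<in> A \<Longrightarrow> \<not> free w \<Longrightarrow> anc w (g w)"
    by metis
  have "inj_on (\<lambda>w. (g w, free w)) A"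
  proof (rule inj_onI)
    fix w w' assume w: "w \<in> A" "w' \<in> A" "(g w, free w) = (g w', free w')"
    have gV: "g w \<in> V"
      using g(1) w(1) marked_V by blast
    show "w = w'"
    proof (cases "free w")
      case True
      \<comment> \<open>Both parents have level 1 and share a descendant; a parent carries at most
        one stem.\<close>
      then have "par w = par w'"
        using anc_unique[OF gV, of "par w" "par w'"] g(2)[of w] g(2)[of w'] w free(2)[of w] free(2)[of w']
        by auto
      then show ?thesis
        using stem_unique free(1)[of w] free(1)[of w'] w True by auto
    next
      case False
      then show ?thesis
        using part_anc_unique[OF gV, of w w'] g(3)[of w] g(3)[of w'] w A[OF w(1)] A[OF w(2)] by auto
    qed
  qed
  then have "card A \<le> 8"
    using card_le_8[OF finite_marked card_marked_le[OF assms(1,2)]] g(1) by blast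
  moreover have "card A = card {w \<in> V. c w = c s} - 1"
    unfolding A_def using sV by simp
  ultimately show False
    using big_part[OF sV(2)] by simp
qed

text \<open>If part \<open>i\<close> has neither, none of its vertices is free, so each has a marked
  descendant. The root lies outside the part, which keeps the part off level 0 and, by saturation,
  within level 4.\<close>

lemma leaf_or_stem:
  assumes "S = {v}" "card E \<le> card V + 1" "c v \<noteq> i" "i < 4"
  shows "(\<exists>l x. leaf_at l x \<and> c l = i) \<or> (\<exists>s y. stem s y \<and> c s = i)"
proof (rule ccontr)
  assume no: "\<not> ?thesis"
  define A where "A = {w \<in> V. c w = i}"
  have vV: "v \<in> V"
    using assms(1) SV by simp
  have A: "w \<in> V" "w \<notin> S" "c w = i" "0 < lev w" "lev w \<le> 4" if "w \<in> A" for w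
  proof -
    show w: "w \<in> V" "c w = i"
      using that by (auto simp: A_def)
    show "w \<notin> S"
      using assms w by auto
    then show "0 < lev w"
      using lev_pos w by blast
    have v0: "lev v = 0"
      using lev_S assms(1) by simp
    show "lev w \<le> 4"
    proof (cases "adj v w")
      case True
      then show ?thesis
        using lev_adj v0 by fastforce
    next
      case False
      then obtain x y z where "adj v x" "adj x y" "adj y z" "adj z w"
        using path4[of v w] vV w assms(3) by auto
      then have "lev x \<le> Suc (lev v)" "lev y \<le> Suc (lev x)" "lev z \<le> Suc (lev y)" "lev w \<le> Suc (lev z)"
        using lev_adj by blast+
      then show ?thesis
        using v0 by simp
    qed
  qed
  have "\<exists>d\<in>marked. anc w d" if "w \<in> A" for w
    using free_stem[OF assms(1), of w] A[OF that] no unfolding free_def by blast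
  then obtain g where g: "\<And>w. w \<in> A \<Longrightarrow> g w \<in> marked" "\<And>w. w \<in> A \<Longrightarrow> anc w (g w)"
    by metis
  \<comment> \<open>Levels in \<open>A\<close> lie between 1 and 4, and on the path from a marked vertex to the root no two
    consecutive vertices lie in \<open>A\<close>: each of the level pairs 1, 2 and 3, 4 contributes one at most.\<close>
  have "inj_on (\<lambda>w. (g w, 3 \<le> lev w)) A"
  proof (rule inj_onI)
    fix w w' assume w: "w \<in> A" "w' \<in> A" "(g w, 3 \<le> lev w) = (g w', 3 \<le> lev w')"
    have "g w \<in> V"
      using g(1) w(1) marked_V by blast
    moreover have "lev w \<le> Suc (lev w')" "lev w' \<le> Suc (lev w)"
      using w A(4,5)[OF w(1)] A(4,5)[OF w(2)] by auto
    ultimately show "w = w'"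
      using part_anc_unique[of "g w" w w'] g(2)[OF w(1)] g(2)[OF w(2)] w A[OF w(1)] A[OF w(2)] by auto
  qed
  then have "card A \<le> 8"
    using card_le_8[OF finite_marked card_marked_le[OF assms(1,2)]] g(1) by blast
  then show False
    using big_part[OF assms(4)] by (simp add: A_def)
qed

section \<open>Forests hanging from a core\<close>

lemma descend:
  assumes "extra = {}" "v \<notin> S" "par v = u" "adj v w" "w \<noteq> u"
  shows "w \<notin> S \<and> par w = v \<and> lev w = Suc (lev v)"
proof -
  have "w \<notin> S \<and> par w = v"
    using edge_cases[OF assms(4)] assms by (auto simp: marked_def)
  then show ?thesis
    using lev_par[of w] adjV[OF assms(4)] by simp
qed

lemma leave_core:
  assumes "extra = {}" "u \<in> S" "adj u v" "v \<notin> S"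
  shows "par v = u"
  using edge_cases[OF assms(3)] assms by (auto simp: marked_def)

text \<open>Here and in the two lemmas that follow, a path that left the core would keep descending
  and never return.\<close>

lemma core_path2:
  assumes "extra = {}" "u \<in> S" "v \<in> S" "adj u a" "adj a v" "u \<noteq> v"
  shows "a \<in> S"
  using leave_core[OF assms(1,2,4)] descend[OF assms(1) _ _ assms(5)] assms by metis

lemma core_path3:
  assumes "extra = {}" "u \<in> S" "v \<in> S" "adj u a" "adj a b" "adj b v" "distinct [u, a, b, v]"
  shows "a \<in> S" "b \<in> S"
proof -
  show a: "a \<in> S"
  proof (rule ccontr)
    assume "a \<notin> S"
    then have "b \<notin> S" "par b = a"
      using descend[OF assms(1) _ leave_core[OF assms(1,2,4)] assms(5)] assms(7) by auto
    then show False
      using descend[OF assms(1) _ _ assms(6)] assms(3,7) by auto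
  qed
  then show "b \<in> S"
    using core_path2[OF assms(1) a assms(3,5,6)] assms(7) by auto
qed

lemma core_path4:
  assumes "extra = {}" "u \<in> S" "v \<in> S" "adj u a" "adj a b" "adj b d" "adj d v" "distinct [u, a, b, d, v]"
  shows "a \<in> S" "b \<in> S" "d \<in> S"
proof -
  show a: "a \<in> S"
  proof (rule ccontr)
    assume "a \<notin> S"
    then have "b \<notin> S" "par b = a"
      using descend[OF assms(1) _ leave_core[OF assms(1,2,4)] assms(5)] assms(8) by auto
    then have "d \<notin> S" "par d = b"
      using descend[OF assms(1) _ _ assms(6)] assms(8) by auto
    then show False
      using descend[OF assms(1) _ _ assms(7)] assms(3,8) by auto
  qed
  then show "b \<in> S" "d \<in> S"
    using core_path3[OF assms(1) a assms(3,5,6,7)] assms(8) by auto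
qed

end

section \<open>The diamond as core\<close>

locale diamond_core = layered_C5 +
  fixes p q r s
  assumes core: "S = {p, q, r, s}" and diamond: "diamond p q r s"
    and no_extra: "extra = {}" and pq: "\<not> adj p q"
begin

lemma core_adj: "adj p r" "adj p s" "adj q r" "adj q s" "adj r s" "adj r p" "adj s p" "adj r q" "adj s q" "adj s r"
  and core_distinct: "distinct [p, q, r, s]"
  using diamond adj_sym by (auto simp: diamond_def)

text \<open>Otherwise saturation gives a path on five vertices between the tips, confined to a core
  of four.\<close>

lemma tips_colour: "c p = c q"
proof (rule ccontr)
  assume "c p \<noteq> c q"
  then obtain x y z where "adj p x" "adj x y" "adj y z" "adj z q" and d: "distinct [p, x, y, z, q]"
    using path4[of p q] pq adjV core_adj(1,3) by blast
  then have "x \<in> {p, q, r, s}" "y \<in> {p, q, r, s}" "z \<in> {p, q, r, s}"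
    using core_path4[OF no_extra, of p q x y z] core by auto
  then show False
    using d by auto
qed

text \<open>\<open>x\<close> is no tip, because \<open>l\<close> is in the part of the tips. That it
  is not on the spine, and where its parent lies, follows from the paths of length 4 from
  \<open>l\<close> to the spine vertices.\<close>

lemma tip_leaf:
  assumes l: "leaf_at l x" "c l = c p"
  shows "x \<notin> S" "par x \<in> {p, q}"
proof -
  have lx: "adj l x" "x \<in> V" "l \<in> V"
    using leaf_at_adj[OF l(1)] adjV by auto
  have cx: "c x \<noteq> c p"
    using proper[OF lx(1)] l(2) by simp
  have crs: "c r \<noteq> c p" "c s \<noteq> c p" "r \<in> V" "s \<in> V"
    using proper core_adj adjV by blast+
  \<comment> \<open>If \<open>x\<close> were on the spine, the path to the other spine vertex would
    use both tips consecutively, but these are not adjacent.\<close>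
  have rs: False if uv: "x = u" "{u, v} = {r, s}" "u \<noteq> v" for u v
  proof -
    have v: "v \<in> S" "u \<in> S" "c v \<noteq> c p" "v \<in> V"
      using that crs core by (auto simp: doubleton_eq_iff)
    obtain a b where ab: "adj u a" "adj a b" "adj b v" "distinct [l, u, a, b, v]"
      using leaf_path4[OF l(1), of v] v l(2) uv by metis
    then have "a \<in> S" "b \<in> S"
      using core_path3[OF no_extra v(2,1) ab(1-3)] by auto
    then have "a \<in> {p, q}" "b \<in> {p, q}"
      using that ab(4) unfolding core by (auto simp: doubleton_eq_iff)
    then show False
      using ab pq adj_sym by auto
  qed
  show xS: "x \<notin> S"
    using rs[of r s] rs[of s r] core_distinct cx tips_colour core by auto
  obtain a b where ab: "adj x a" "adj a b" "adj b r" "distinct [l, x, a, b, r]"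
    using leaf_path4[OF l(1), of r] crs l(2) xS core by auto
  obtain a' b' where ab': "adj x a'" "adj a' b'" "adj b' s" "distinct [l, x, a', b', s]"
    using leaf_path4[OF l(1), of s] crs l(2) xS core by auto
  \<comment> \<open>A path from \<open>x\<close> to the core cannot start downwards, so it follows
    parents until it meets the core.\<close>
  have up: "u = par x \<and> (u \<in> S \<or> w = par u \<and> (w \<in> S \<or> v = par w))"
    if "adj x u" "adj u w" "adj w v" "distinct [l, x, u, w, v]" "v \<in> S" for u v w
  proof -
    have u: "u = par x"
    proof (rule ccontr)
      assume "u \<noteq> par x"
      then have "u \<notin> S" "par u = x"
        using descend[OF no_extra xS refl that(1)] by auto
      then have "w \<notin> S" "par w = u"
        using descend[OF no_extra _ _ that(2)] that(4) by auto
      then show False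
        using descend[OF no_extra _ _ that(3)] that(4,5) by auto
    qed
    have w: "w = par u" if uS: "u \<notin> S"
    proof (rule ccontr)
      assume "w \<noteq> par u"
      then have "w \<notin> S" "par w = u"
        using descend[OF no_extra uS refl \<open>adj u w\<close>] by auto
      then show False
        using descend[OF no_extra _ _ \<open>adj w v\<close>] \<open>distinct [l, x, u, w, v]\<close> \<open>v \<in> S\<close> by auto
    qed
    have "v = par w" if "w \<notin> S"
      using descend[OF no_extra that refl \<open>adj w v\<close>] \<open>v \<in> S\<close> by auto
    then show ?thesis
      using u w by blast
  qed
  have a: "a = par x" "a \<in> S \<or> b = par a \<and> (b \<in> S \<or> r = par b)"
    using up[OF ab] core by auto
  have a': "a' = par x" "a' \<in> S \<or> b' = par a' \<and> (b' \<in> S \<or> s = par b')"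
    using up[OF ab'] core by auto
  have aS: "a \<in> S"
  proof (rule ccontr)
    assume aS: "a \<notin> S"
    \<comment> \<open>Both paths climb through the same grandparent of \<open>x\<close>. It is in
      the core, since otherwise \<open>r\<close> and \<open>s\<close> would both be its
      parent.\<close>
    then have "b = b'"
      using a a' by auto
    then have bS: "b \<in> S"
      using aS a a' core_distinct by auto
    then have b: "b = p \<or> b = q"
      using ab(4) ab'(4) \<open>b = b'\<close> core by auto
    have "c a \<noteq> c l"
      using proper[OF ab(2)] b l(2) tips_colour by auto
    \<comment> \<open>As a neighbour of a tip, \<open>a\<close> is outside the part of
      \<open>l\<close>. The path from \<open>l\<close> to \<open>a\<close> can only descend from
      \<open>x\<close>, yet \<open>a\<close> is the parent of \<open>x\<close>.\<close>
    then obtain e f where ef: "adj x e" "adj e f" "adj f a" "distinct [l, x, e, f, a]"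
      using leaf_path4[OF l(1), of a] adjV[OF ab(1)] ab(4) by (metis distinct_length_2_or_more)
    have "e \<notin> S" "par e = x" "lev e = Suc (lev x)"
      using descend[OF no_extra xS refl ef(1)] ef(4) a(1) by auto
    then have "f \<notin> S" "par f = e" "lev f = Suc (lev e)"
      using descend[OF no_extra _ _ ef(2)] ef(4) by auto
    then have "lev a = Suc (lev f)"
      using descend[OF no_extra _ _ ef(3)] ef(4) by auto
    then show False
      using \<open>lev f = _\<close> \<open>lev e = _\<close> lev_par[OF lx(2) xS] a(1) by simp
  qed
  then show "par x \<in> {p, q}"
    using a a' ab(4) ab'(4) core by auto
qed

text \<open>The path from \<open>l\<close> to \<open>l'\<close> runs through \<open>x\<close>, a
  vertex \<open>u\<close> and \<open>x'\<close>. Here \<open>u\<close> is the tip above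
  \<open>x\<close>, since otherwise \<open>x'\<close> would be too deep for the paths from
  \<open>l'\<close> to the spine. So \<open>x'\<close> is adjacent to that tip, and it is in the
  core because a path from \<open>l'\<close> back to the tip could not descend first.\<close>

lemma other_leaf:
  assumes l: "leaf_at l x" "c l = c p" and l': "leaf_at l' x'" "c l' \<noteq> c p"
  shows "x' \<in> {r, s}"
proof -
  define t where "t = par x"
  have xS: "x \<notin> S" and t: "t = p \<or> t = q"
    using tip_leaf[OF l] by (auto simp: t_def)
  have tt: "t \<in> S" "adj t r" "adj t s" "c t = c p" "t \<noteq> r" "t \<noteq> s" "t \<in> V"
    using t core core_adj tips_colour core_distinct adjV by auto
  have V: "l \<in> V" "x \<in> V" "l' \<in> V" "x' \<in> V" "r \<in> V" "s \<in> V"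
    using leaf_at_adj[OF l(1)] leaf_at_adj[OF l'(1)] adjV core_adj(5) by auto
  have tx: "adj x t"
    using adj_par V xS t_def by auto
  have "l' \<noteq> x"
  proof
    assume "l' = x"
    then have "l = t"
      using leaf_atD(1)[OF l'(1)] tx leaf_at_adj[OF l(1)] adj_sym by metis
    then show False
      using leaf_atD(1)[OF l(1)] tt(2,3) core_distinct by auto
  qed
  then obtain u w where uw: "adj x u" "adj u w" "adj w l'" "distinct [l, x, u, w, l']"
    using leaf_path4[OF l(1), of l'] V l(2) l'(2) by metis
  have w: "w = x'"
    using leaf_atD(2)[OF l'(1) uw(3)] .
  have levx: "lev x = 1"
    using lev_par[OF V(2) xS] lev_S[OF tt(1)] t_def by simp
  have ut: "u = t"
  proof (rule ccontr)
    assume "u \<noteq> t"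
    then have u: "u \<notin> S" "par u = x" "lev u = 2"
      using descend[OF no_extra xS _ uw(1)] levx t_def by auto
    then have x': "x' \<notin> S" "par x' = u" "lev x' = 3"
      using descend[OF no_extra _ _ uw(2)] uw(4) w by auto
    then have l'S: "l' \<notin> S" "par l' = x'"
      using descend[OF no_extra _ _ uw(3)] uw(4) w by auto
    \<comment> \<open>From level 3 the core is reached in three steps only via \<open>u\<close> and
      \<open>x\<close>, but the only core neighbour of \<open>x\<close> is \<open>t\<close>. As
      \<open>r\<close> and \<open>s\<close> are adjacent, one of them is outside the part of
      \<open>l'\<close>.\<close>
    have far: False if v: "v \<in> {r, s}" "c l' \<noteq> c v" for v
    proof -
      have "v \<in> V" "v \<noteq> x'" "v \<in> S"
        using v V x' core by auto
      then obtain a b where ab: "adj x' a" "adj a b" "adj b v" "distinct [l', x', a, b, v]"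
        using leaf_path4[OF l'(1) v(2)] by metis
      have "lev v = 0"
        using lev_S \<open>v \<in> S\<close> by simp
      then have "lev b \<le> 1" "lev a \<le> 2"
        using lev_adj[of v b] lev_adj[of b a] ab adj_sym by auto
      then have "a = u"
        using descend[OF no_extra x'(1,2) ab(1)] x'(3) by auto
      then have "b = x"
        using descend[OF no_extra u(1,2), of b] ab(2) \<open>lev b \<le> 1\<close> u(3) by auto
      then show False
        using descend[OF no_extra xS, of t v] ab(3) t_def \<open>v \<in> S\<close> v(1) tt(5,6) by auto
    qed
    then show False
      using far[of r] far[of s] proper[OF core_adj(5)] by (metis insertI1 insertI2)
  qed
  have "x' \<in> S"
  proof (rule ccontr)
    assume x'S: "x' \<notin> S"
    have px': "par x' = t"
      using leave_core[OF no_extra tt(1) _ x'S] uw(2) ut w by simp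
    have "t \<noteq> x'"
      using x'S tt(1) by auto
    then obtain a b where ab: "adj x' a" "adj a b" "adj b t" "distinct [l', x', a, b, t]"
      using leaf_path4[OF l'(1), of t] l'(2) tt(4,7) by metis
    then have "a \<notin> S" "par a = x'"
      using descend[OF no_extra x'S px' ab(1)] by auto
    then have "b \<notin> S" "par b = a"
      using descend[OF no_extra _ _ ab(2)] ab(4) by auto
    then show False
      using descend[OF no_extra _ _ ab(3)] ab(4) tt(1) by auto
  qed
  then show ?thesis
    using uw(2,4) ut w t pq core adj_sym by auto
qed

text \<open>The leaves of the three parts without tips would hang at the two spine vertices, at
  different ones for different parts.\<close>

lemma some_part_without_leaf: "\<exists>i<4. \<nexists>l x. leaf_at l x \<and> c l = i"
proof (rule ccontr)
  assume "\<not> ?thesis"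
  then have leaf: "\<exists>l x. leaf_at l x \<and> c l = i" if "i < 4" for i
    using that by auto
  then obtain L X where LX: "\<And>i. i < 4 \<Longrightarrow> leaf_at (L i) (X i) \<and> c (L i) = i"
    by metis
  have cp: "c p < 4"
    using colour_less adjV core_adj(1) by blast
  have "X i \<in> {r, s}" if "i \<in> {..<4} - {c p}" for i
    using other_leaf[of "L (c p)" "X (c p)" "L i" "X i"] LX[OF cp] LX[of i] that by auto
  then have "card ({..<4} - {c p}) \<le> card {r, s}"
  proof (intro card_inj_on_le[of X])
    show "inj_on X ({..<4} - {c p})"
    proof (rule inj_onI)
      fix i j assume "i \<in> {..<4} - {c p}" "j \<in> {..<4} - {c p}" "X i = X j"
      then show "i = j"
        using leaf_same_parent[of "L i" "X i" "L j"] LX[of i] LX[of j] by auto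
    qed
  qed auto
  moreover have "card {r, s} \<le> 2"
    by (simp add: card_insert_if)
  ultimately show False
    using cp by simp
qed

end

section \<open>The lower bound\<close>

context C5_saturated
begin

text \<open>Two layerings are used: one rooted outside part \<open>i\<close> to get a leaf or a stem
  there, and one rooted at \<open>y\<close> to turn a stem at \<open>y\<close> into a leaf.\<close>

lemma leaf_in_each_part:
  assumes "card E \<le> card V + 1" "i < 4"
  shows "\<exists>l x. leaf_at l x \<and> c l = i"
proof -
  have st: "\<exists>l x. leaf_at l x \<and> c l = c s" if sy: "stem s y" for s y
  proof -
    have "{y} \<subseteq> V"
      using sy adjV by (auto simp: stem_def)
    then obtain lev par where "layering V E {y} lev par"
      using layering_exists[of "{y}"] by blast
    then interpret layered_C5 V E c "{y}" lev par
      by (intro layered_C5.intro C5_saturated_axioms)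
    show ?thesis
      using stem_imp_leaf assms(1) sy by blast
  qed
  have "(if i = 0 then 1 else 0) < (4 :: nat)" "(if i = 0 then 1 else 0) \<noteq> i"
    by auto
  then obtain v where v: "v \<in> V" "c v \<noteq> i"
    using colour_exists by metis
  then obtain lev par where "layering V E {v} lev par"
    using layering_exists[of "{v}"] by blast
  then interpret layered_C5 V E c "{v}" lev par
    by (intro layered_C5.intro C5_saturated_axioms)
  show ?thesis
    using leaf_or_stem[of v i] assms v st by blast
qed

lemma card_edges_ge: "card V + 2 \<le> card E"
proof (rule ccontr)
  assume "\<not> ?thesis"
  then have few: "card E \<le> card V + 1"
    by simp
  have leaf: "\<exists>l x. leaf_at l x \<and> c l = i" if "i < 4" for i
    using leaf_in_each_part[OF few that] .
  then obtain p q r s where d: "diamond p q r s"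
    using diamond_exists by blast
  let ?S = "{p, q, r, s}"
  have dist: "distinct [p, q, r, s]" and
    e: "{p, r} \<in> E" "{p, s} \<in> E" "{q, r} \<in> E" "{q, s} \<in> E" "{r, s} \<in> E"
    using d by (auto simp: diamond_def adj_def)
  have SV: "?S \<subseteq> V"
    using d adjV by (auto simp: diamond_def)
  then obtain lev par where "layering V E ?S lev par"
    using layering_exists[of ?S] by blast
  then interpret layered_C5 V E c ?S lev par
    by (intro layered_C5.intro C5_saturated_axioms)
  have S4: "card ?S = 4"
    using dist by simp
  then have VS: "card (V - ?S) + 4 = card V"
    using SV finV card_mono[of V ?S] by (simp add: card_Diff_subset)
  let ?F = "{{p, r}, {p, s}, {q, r}, {q, s}, {r, s}}"
  have F: "card ?F = 5" "{p, q} \<notin> ?F" "?F \<subseteq> inner"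
    using dist e by (auto simp: doubleton_eq_iff inner_def)
  have fin: "finite inner"
    using finE by (simp add: inner_def)
  have "card inner \<ge> 5"
    using card_mono[OF fin F(3)] F(1) by simp
  \<comment> \<open>Five diamond edges and one tree edge per vertex outside the core already make
    \<open>card V + 1\<close>, so neither an extra edge nor an edge between the tips fits.\<close>
  then have *: "card extra = 0" "card inner = 5"
    using card_edges few VS by linarith+
  have ext: "extra = {}"
    using *(1) finE by (simp add: extra_def)
  have "\<not> adj p q"
  proof
    assume "adj p q"
    then have "insert {p, q} ?F \<subseteq> inner"
      using F(3) by (simp add: adj_def inner_def)
    then have "card (insert {p, q} ?F) \<le> 5"
      using card_mono[OF fin] *(2) by metis
    then show False
      using F(1,2) by simp
  qed
  then interpret diamond_core V E c ?S lev par p q r s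
    by unfold_locales (use d ext in auto)
  show False
    using some_part_without_leaf leaf by blast
qed

end


section \<open>From saturation in the multipartite graph to paths of length 4\<close>

lemma edge_complete_multipartite:
  "{u, v} \<in> edges (complete_multipartite k n) \<longleftrightarrow>
     u \<in> {..<k} \<times> {..<n} \<and> v \<in> {..<k} \<times> {..<n} \<and> fst u \<noteq> fst v"
  by (cases u; cases v) (auto simp: complete_multipartite_def doubleton_eq_iff)

lemma lessThan_5: "{..<5 :: nat} = {0, 1, 2, 3, 4}"
  by auto

lemma edges_C5: "edges (cycle_graph 5) = {{0, 1}, {1, 2}, {2, 3}, {3, 4}, {4, 0}}"
proof -
  have m: "Suc 0 mod 5 = 1" "Suc 1 mod 5 = 2" "Suc 2 mod 5 = 3" "Suc 3 mod 5 = 4" "Suc 4 mod 5 = 0"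
    by simp_all
  have "edges (cycle_graph 5) = (\<lambda>i. {i, Suc i mod 5}) ` {..<5}"
    unfolding cycle_graph_def by fastforce
  then show ?thesis
    unfolding lessThan_5 by (simp only: image_insert image_empty m)
qed

lemma verts_C5: "verts (cycle_graph 5) = {0, 1, 2, 3, 4}"
  by (simp only: cycle_graph_def fst_conv lessThan_5)

lemma contains_C5_iff:
  "contains_copy H (cycle_graph 5) \<longleftrightarrow>
    (\<exists>v\<^sub>1 v\<^sub>2 v\<^sub>3 v\<^sub>4 v\<^sub>5. distinct [v\<^sub>1, v\<^sub>2, v\<^sub>3, v\<^sub>4, v\<^sub>5] \<and> v\<^sub>1 \<in> verts H \<and> v\<^sub>2 \<in> verts H \<and> v\<^sub>3 \<in> verts H \<and> 
      v\<^sub>4 \<in> verts H \<and> v\<^sub>5 \<in> verts H \<and>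
      {v\<^sub>1, v\<^sub>2} \<in> edges H \<and> {v\<^sub>2, v\<^sub>3} \<in> edges H \<and> {v\<^sub>3, v\<^sub>4} \<in> edges H \<and>
      {v\<^sub>4, v\<^sub>5} \<in> edges H \<and> {v\<^sub>5, v\<^sub>1} \<in> edges H)"
  (is "?L \<longleftrightarrow> ?R")
proof
  assume ?L
  then obtain f where f: "inj_on f (verts (cycle_graph 5))" "f ` verts (cycle_graph 5) \<subseteq> verts H"
    "\<And>e. e \<in> edges (cycle_graph 5) \<Longrightarrow> f ` e \<in> edges H"
    unfolding contains_copy_def by metis
  have "f ` {i, j} \<in> edges H" if "{i, j} \<in> edges (cycle_graph 5)" for i j
    using f(3) that .
  then have e: "{f 0, f 1} \<in> edges H" "{f 1, f 2} \<in> edges H" "{f 2, f 3} \<in> edges H"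
    "{f 3, f 4} \<in> edges H" "{f 4, f 0} \<in> edges H"
    by (simp_all add: edges_C5)
  have "distinct [f 0, f 1, f 2, f 3, f 4]"
    using f(1) by (simp add: verts_C5 inj_on_def)
  moreover have "f 0 \<in> verts H" "f 1 \<in> verts H" "f 2 \<in> verts H" "f 3 \<in> verts H" "f 4 \<in> verts H"
    using f(2) by (simp_all add: verts_C5)
  ultimately show ?R
    using e by (intro exI conjI)
next
  assume ?R
  then obtain v\<^sub>1 v\<^sub>2 v\<^sub>3 v\<^sub>4 v\<^sub>5 where v: "distinct [v\<^sub>1, v\<^sub>2, v\<^sub>3, v\<^sub>4, v\<^sub>5]" "v\<^sub>1 \<in> verts H" "v\<^sub>2 \<in> verts H" "v\<^sub>3 \<in> verts H" "v\<^sub>4 \<in> verts H" "v\<^sub>5 \<in> verts H"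
    "{v\<^sub>1, v\<^sub>2} \<in> edges H" "{v\<^sub>2, v\<^sub>3} \<in> edges H" "{v\<^sub>3, v\<^sub>4} \<in> edges H"
    "{v\<^sub>4, v\<^sub>5} \<in> edges H" "{v\<^sub>5, v\<^sub>1} \<in> edges H"
    by blast
  define f where "f = (!) [v\<^sub>1, v\<^sub>2, v\<^sub>3, v\<^sub>4, v\<^sub>5]"
  have f: "f 0 = v\<^sub>1" "f 1 = v\<^sub>2" "f (Suc 0) = v\<^sub>2" "f 2 = v\<^sub>3" "f 3 = v\<^sub>4" "f 4 = v\<^sub>5"
    by (simp_all add: f_def)
  show ?L
    unfolding contains_copy_def edges_C5 verts_C5
    by (rule exI[of _ f]) (use v f in auto)
qed

text \<open>The 5-cycle uses the new edge. Rotated to begin with it, the other four edges are the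
  path, read in one of the two directions.\<close>

lemma path4_of_C5_through_edge:
  assumes "{v\<^sub>1, v\<^sub>2} \<in> insert {u, v} E" "{v\<^sub>2, v\<^sub>3} \<in> insert {u, v} E" "{v\<^sub>3, v\<^sub>4} \<in> insert {u, v} E"
    "{v\<^sub>4, v\<^sub>5} \<in> insert {u, v} E" "{v\<^sub>5, v\<^sub>1} \<in> insert {u, v} E"
    and distinct: "distinct [v\<^sub>1, v\<^sub>2, v\<^sub>3, v\<^sub>4, v\<^sub>5]"
    and not_in_E: "\<not> {{v\<^sub>1, v\<^sub>2}, {v\<^sub>2, v\<^sub>3}, {v\<^sub>3, v\<^sub>4}, {v\<^sub>4, v\<^sub>5}, {v\<^sub>5, v\<^sub>1}} \<subseteq> E"
  shows "\<exists>x y z. {u, x} \<in> E \<and> {x, y} \<in> E \<and> {y, z} \<in> E \<and> {z, v} \<in> E \<and> distinct [u, x, y, z, v]"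
proof -
  have first: ?thesis if path: "{a, b} = {u, v}" "distinct [a, b, d, e, f]" "{b, d} \<in> insert {u, v} E"
    "{d, e} \<in> insert {u, v} E" "{e, f} \<in> insert {u, v} E" "{f, a} \<in> insert {u, v} E" for a b d e f
  proof -
    have E: "{b, d} \<in> E" "{d, e} \<in> E" "{e, f} \<in> E" "{f, a} \<in> E"
      using path by (auto simp: doubleton_eq_iff)
    have rev: "{d, b} \<in> E" "{e, d} \<in> E" "{f, e} \<in> E" "{a, f} \<in> E"
      using E by (simp_all add: insert_commute)
    consider "u = a" "v = b" | "u = b" "v = a"
      using path(1) by (auto simp: doubleton_eq_iff)
    then show ?thesis
    proof cases
      case 1
      then show ?thesis
        by (intro exI[of _ f] exI[of _ e] exI[of _ d])
          (use rev path(2) in auto)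
    next
      case 2
      then show ?thesis
        by (intro exI[of _ d] exI[of _ e] exI[of _ f]) (use E path(2) in auto)
    qed
  qed
  consider "{v\<^sub>1, v\<^sub>2} = {u, v}" | "{v\<^sub>2, v\<^sub>3} = {u, v}" | "{v\<^sub>3, v\<^sub>4} = {u, v}" | "{v\<^sub>4, v\<^sub>5} = {u, v}"
    | "{v\<^sub>5, v\<^sub>1} = {u, v}"
    using assms(1-5) not_in_E empty_subsetI[of E] unfolding insert_iff[of _ "{u, v}"] insert_subset
    by satx
  then show ?thesis
  proof cases
    case 1
    show ?thesis
      by (rule first[OF 1 distinct assms(2-5)])
  next
    case 2
    show ?thesis
      by (rule first[OF 2 _ assms(3,4,5,1)]) (use distinct in auto)
  next
    case 3
    show ?thesis
      by (rule first[OF 3 _ assms(4,5,1,2)]) (use distinct in auto)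
  next
    case 4
    show ?thesis
      by (rule first[OF 4 _ assms(5,1,2,3)]) (use distinct in auto)
  next
    case 5
    show ?thesis
      by (rule first[OF 5 _ assms(1-4)]) (use distinct in auto)
  qed
qed

text \<open>The part of a vertex is its first coordinate, and the bound on \<open>n\<close> becomes
  \<open>big_part\<close>.\<close>

lemma saturated_imp_C5_saturated:
  assumes "n \<ge> 10" and sat: "saturated (complete_multipartite 4 n) (cycle_graph 5) H"
  shows "C5_saturated (verts H) (edges H) fst"
proof -
  have V: "verts H = {..<4} \<times> {..<n}" and EG: "edges H \<subseteq> edges (complete_multipartite 4 n)"
    and C5: "\<not> contains_copy H (cycle_graph 5)"
    using sat by (auto simp: saturated_def spanning_subgraph_def complete_multipartite_def)
  interpret fin_graph "verts H" "edges H"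
  proof
    show "finite (verts H)"
      by (simp add: V)
    fix e assume "e \<in> edges H"
    then have eG: "e \<in> edges (complete_multipartite 4 n)"
      using EG by blast
    then obtain u v where "e = {u, v}"
      by (auto simp: complete_multipartite_def)
    then show "\<exists>u v. e = {u, v} \<and> u \<noteq> v \<and> u \<in> verts H \<and> v \<in> verts H"
      using eG edge_complete_multipartite[of u v 4 n] V by auto
  qed
  show ?thesis
  proof
    fix u v assume "adj u v"
    then show "fst u \<noteq> fst v"
      using EG edge_complete_multipartite[of u v 4 n] by (auto simp: adj_def)
  next
    fix v\<^sub>1 v\<^sub>2 v\<^sub>3 v\<^sub>4 v\<^sub>5
    assume a: "adj v\<^sub>1 v\<^sub>2" "adj v\<^sub>2 v\<^sub>3" "adj v\<^sub>3 v\<^sub>4" "adj v\<^sub>4 v\<^sub>5" "adj v\<^sub>5 v\<^sub>1"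
    then have "v\<^sub>1 \<in> verts H" "v\<^sub>2 \<in> verts H" "v\<^sub>3 \<in> verts H" "v\<^sub>4 \<in> verts H" "v\<^sub>5 \<in> verts H"
      using adjV by blast+
    then show "\<not> distinct [v\<^sub>1, v\<^sub>2, v\<^sub>3, v\<^sub>4, v\<^sub>5]"
      using C5 a unfolding contains_C5_iff adj_def by blast
  next
    fix u v assume uv: "u \<in> verts H" "v \<in> verts H" "fst u \<noteq> fst v" "\<not> adj u v"
    then have "{u, v} \<in> edges (complete_multipartite 4 n) - edges H"
      unfolding Diff_iff edge_complete_multipartite by (simp add: V adj_def)
    then have "contains_copy (add_edge H {u, v}) (cycle_graph 5)"
      using sat by (simp add: saturated_def)
    from this[unfolded contains_C5_iff add_edge_def fst_conv snd_conv]
    obtain v\<^sub>1 v\<^sub>2 v\<^sub>3 v\<^sub>4 v\<^sub>5 where v: "distinct [v\<^sub>1, v\<^sub>2, v\<^sub>3, v\<^sub>4, v\<^sub>5]"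
      "v\<^sub>1 \<in> verts H" "v\<^sub>2 \<in> verts H" "v\<^sub>3 \<in> verts H"
      "v\<^sub>4 \<in> verts H" "v\<^sub>5 \<in> verts H"
      "{v\<^sub>1, v\<^sub>2} \<in> insert {u, v} (edges H)" "{v\<^sub>2, v\<^sub>3} \<in> insert {u, v} (edges H)"
      "{v\<^sub>3, v\<^sub>4} \<in> insert {u, v} (edges H)" "{v\<^sub>4, v\<^sub>5} \<in> insert {u, v} (edges H)"
      "{v\<^sub>5, v\<^sub>1} \<in> insert {u, v} (edges H)"
      by (elim exE conjE) (rule that)
    have "\<not> {{v\<^sub>1, v\<^sub>2}, {v\<^sub>2, v\<^sub>3}, {v\<^sub>3, v\<^sub>4}, {v\<^sub>4, v\<^sub>5}, {v\<^sub>5, v\<^sub>1}} \<subseteq> edges H"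
      using C5 v(1-6) unfolding contains_C5_iff insert_subset by blast
    then show "\<exists>x y z. adj u x \<and> adj x y \<and> adj y z \<and> adj z v \<and> distinct [u, x, y, z, v]"
      unfolding adj_def by (rule path4_of_C5_through_edge[OF v(7-11) v(1)])
  next
    fix v assume "v \<in> verts H"
    then show "fst v < 4"
      by (auto simp: V)
  next
    fix i :: nat assume "i < 4"
    then have "{v \<in> verts H. fst v = i} = {i} \<times> {..<n}"
      by (auto simp: V)
    then show "10 \<le> card {v \<in> verts H. fst v = i}"
      using assms(1) by (simp add: card_cartesian_product)
  qed
qed

section \<open>The upper bound: a complete core with leaves\<close>

definition K4_edges :: "(nat \<times> nat) set set" where
  "K4_edges = {{(i, 0), (j, 0)} | i j. i < 4 \<and> j < 4 \<and> i \<noteq> j}"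

text \<open>The cyclic shift of parts has no fixed point, so each edge joins different parts, and it
  is injective, so leaves of different parts hang at different core vertices.\<close>

definition leaf_edges :: "nat \<Rightarrow> (nat \<times> nat) set set" where
  "leaf_edges n = (\<lambda>(i, a). {(i, a), (Suc i mod 4, 0)}) ` ({..<4} \<times> {1..<n})"

definition K4_with_leaves :: "nat \<Rightarrow> (nat \<times> nat) graph" where
  "K4_with_leaves n = ({..<4} \<times> {..<n}, K4_edges \<union> leaf_edges n)"

lemma K4_edges_eq:
  "K4_edges = {{(0, 0), (1, 0)}, {(0, 0), (2, 0)}, {(0, 0), (3, 0)},
    {(1, 0), (2, 0)}, {(1, 0), (3, 0)}, {(2, 0), (3, 0)}}" (is "_ = ?K")
proof
  show "K4_edges \<subseteq> ?K"
  proof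
    fix e assume "e \<in> K4_edges"
    then obtain i j :: nat where ij: "e = {(i, 0), (j, 0)}" "i < 4" "j < 4" "i \<noteq> j"
      unfolding K4_edges_def by blast
    have "i \<in> {0, 1, 2, 3}" "j \<in> {0, 1, 2, 3}"
      using ij by auto
    then show "e \<in> ?K"
      using ij(1,4) by (elim insertE emptyE) (simp_all add: insert_commute)
  qed
  have "{(i, 0), (j, 0)} \<in> K4_edges" if "i < 4" "j < 4" "i \<noteq> j" for i j
    using that unfolding K4_edges_def by blast
  then show "?K \<subseteq> K4_edges"
    by simp
qed

lemma card_K4_edges: "card K4_edges = 6"
  unfolding K4_edges_eq by (simp add: doubleton_eq_iff)

lemma card_leaf_edges: "card (leaf_edges n) = 4 * (n - 1)"
proof -
  have "inj_on (\<lambda>(i, a). {(i, a), (Suc i mod 4, 0)}) ({..<4} \<times> {1..<n})"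
    by (auto simp: inj_on_def doubleton_eq_iff)
  then show ?thesis
    unfolding leaf_edges_def by (simp add: card_image card_cartesian_product)
qed

lemma card_K4_with_leaves:
  assumes "n \<ge> 1"
  shows "card (edges (K4_with_leaves n)) = 4 * n + 2"
proof -
  have "\<forall>v\<in>e. snd v = 0" if "e \<in> K4_edges" for e
    using that unfolding K4_edges_def by fastforce
  moreover have "\<exists>v\<in>e. snd v \<noteq> 0" if "e \<in> leaf_edges n" for e
    using that unfolding leaf_edges_def by fastforce
  ultimately have "K4_edges \<inter> leaf_edges n = {}"
    by (metis disjoint_iff)
  moreover have "finite K4_edges"
    by (simp add: K4_edges_eq)
  moreover have "finite (leaf_edges n)"
    by (simp add: leaf_edges_def)
  ultimately have "card (K4_edges \<union> leaf_edges n) = 6 + 4 * (n - 1)"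
    by (simp add: card_Un_disjoint card_K4_edges card_leaf_edges)
  then show ?thesis
    using assms by (simp add: K4_with_leaves_def)
qed

lemma K4_edge: "i < 4 \<Longrightarrow> j < 4 \<Longrightarrow> i \<noteq> j \<Longrightarrow> {(i, 0), (j, 0)} \<in> edges (K4_with_leaves n)"
  by (auto simp: K4_with_leaves_def K4_edges_def)

lemma leaf_edge:
  "i < 4 \<Longrightarrow> 0 < a \<Longrightarrow> a < n \<Longrightarrow> {(i, a), (Suc i mod 4, 0)} \<in> edges (K4_with_leaves n)"
  by (force simp: K4_with_leaves_def leaf_edges_def)

lemma K4_with_leaves_nbr:
  "{(i, a), v} \<in> edges (K4_with_leaves n) \<Longrightarrow> 0 < a \<Longrightarrow> v = (Suc i mod 4, 0)"
  by (auto simp: K4_with_leaves_def K4_edges_def leaf_edges_def doubleton_eq_iff)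

text \<open>A vertex on a cycle has two neighbours, hence lies in the core, which has only four
  vertices.\<close>

lemma K4_with_leaves_C5_free: "\<not> contains_copy (K4_with_leaves n) (cycle_graph 5)"
proof
  let ?H = "K4_with_leaves n" and ?E = "edges (K4_with_leaves n)"
  assume "contains_copy (K4_with_leaves n) (cycle_graph 5)"
  then obtain v\<^sub>1 v\<^sub>2 v\<^sub>3 v\<^sub>4 v\<^sub>5 where v: "distinct [v\<^sub>1, v\<^sub>2, v\<^sub>3, v\<^sub>4, v\<^sub>5]"
    "v\<^sub>1 \<in> verts ?H" "v\<^sub>2 \<in> verts ?H" "v\<^sub>3 \<in> verts ?H"
    "v\<^sub>4 \<in> verts ?H" "v\<^sub>5 \<in> verts ?H"
    "{v\<^sub>1, v\<^sub>2} \<in> ?E" "{v\<^sub>2, v\<^sub>3} \<in> ?E" "{v\<^sub>3, v\<^sub>4} \<in> ?E" "{v\<^sub>4, v\<^sub>5} \<in> ?E" "{v\<^sub>5, v\<^sub>1} \<in> ?E"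
    unfolding contains_C5_iff by (elim exE conjE) (rule that)
  have mid: "v \<in> {..<4} \<times> {0}"
    if "{u, v} \<in> ?E" "{v, w} \<in> ?E" "u \<noteq> w" "v \<in> verts (K4_with_leaves n)" for u v w
  proof -
    obtain i a where ia: "v = (i, a)"
      by fastforce
    have "a = 0"
      using K4_with_leaves_nbr[of i a u n] K4_with_leaves_nbr[of i a w n] that ia
      by (auto simp: insert_commute)
    then show ?thesis
      using that(4) ia by (auto simp: K4_with_leaves_def)
  qed
  have "{v\<^sub>1, v\<^sub>2, v\<^sub>3, v\<^sub>4, v\<^sub>5} \<subseteq> {..<4} \<times> {0}"
    using mid[OF v(11,7)] mid[OF v(7,8)] mid[OF v(8,9)] mid[OF v(9,10)] mid[OF v(10,11)] v(1-6)
      by (simp add: not_sym)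
  then have "card {v\<^sub>1, v\<^sub>2, v\<^sub>3, v\<^sub>4, v\<^sub>5} \<le> card ({..<4 :: nat} \<times> {0 :: nat})"
    by (intro card_mono) auto
  then show False
    using v(1) by (simp add: card_cartesian_product)
qed

lemma two_others:
  fixes i j :: nat
  assumes "i < 4" "j < 4" "i \<noteq> j"
  obtains k m where "k < 4" "m < 4" "distinct [i, j, k, m]"
proof -
  have "card ({..<4} - {i, j}) = 2"
    using assms by (simp add: card_Diff_subset)
  then obtain k m where "{..<4} - {i, j} = {k, m}" "k \<noteq> m"
    by (auto simp: card_2_iff)
  then have "k < 4" "m < 4" "distinct [i, j, k, m]"
    using assms by auto
  then show ?thesis
    by (rule that)
qed

lemma C5_in_add_edge:
  assumes "{v\<^sub>2, v\<^sub>3} \<in> edges H" "{v\<^sub>3, v\<^sub>4} \<in> edges H" "{v\<^sub>4, v\<^sub>5} \<in> edges H" "{v\<^sub>5, v\<^sub>1} \<in> edges H"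
    "distinct [v\<^sub>1, v\<^sub>2, v\<^sub>3, v\<^sub>4, v\<^sub>5]" "{v\<^sub>1, v\<^sub>2, v\<^sub>3, v\<^sub>4, v\<^sub>5} \<subseteq> verts H"
  shows "contains_copy (add_edge H {v\<^sub>1, v\<^sub>2}) (cycle_graph 5)"
  unfolding contains_C5_iff
  by (intro exI[of _ v\<^sub>1] exI[of _ v\<^sub>2] exI[of _ v\<^sub>3] exI[of _ v\<^sub>4] exI[of _ v\<^sub>5])
    (use assms in \<open>simp add: add_edge_def\<close>)

text \<open>As the edge is missing, \<open>(j, 0)\<close> is not the neighbour of the leaf. A path
  through all four core vertices joins the two and closes the cycle.\<close>

lemma add_leaf_core_edge:
  assumes "i < 4" "j < 4" "0 < a" "a < n" "{(i, a), (j, 0)} \<notin> edges (K4_with_leaves n)"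
  shows "contains_copy (add_edge (K4_with_leaves n) {(i, a), (j, 0)}) (cycle_graph 5)"
proof -
  let ?x = "Suc i mod 4"
  have x: "?x < 4" "j \<noteq> ?x"
    using assms leaf_edge by auto
  then obtain k m where k: "k < 4" "m < 4" "distinct [j, ?x, k, m]"
    using two_others assms(2) by blast
  show ?thesis
  proof (rule C5_in_add_edge[of _ "(k, 0)" _ "(m, 0)" "(?x, 0)"])
    show "{(j, 0), (k, 0)} \<in> edges (K4_with_leaves n)" "{(k, 0), (m, 0)} \<in> edges (K4_with_leaves n)"
      "{(m, 0), (?x, 0)} \<in> edges (K4_with_leaves n)"
      using x k assms(2) by (auto intro!: K4_edge)
    show "{(?x, 0), (i, a)} \<in> edges (K4_with_leaves n)"
      using leaf_edge[of i a n] assms by (simp add: insert_commute)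
  qed (use x k assms in \<open>auto simp: K4_with_leaves_def\<close>)
qed

text \<open>The leaves hang at different core vertices, which a third core vertex joins by a path of
  length 2.\<close>

lemma add_leaf_leaf_edge:
  assumes "i < 4" "j < 4" "i \<noteq> j" "0 < a" "a < n" "0 < b" "b < n"
  shows "contains_copy (add_edge (K4_with_leaves n) {(i, a), (j, b)}) (cycle_graph 5)"
proof -
  let ?x = "Suc i mod 4" and ?y = "Suc j mod 4"
  have x: "?x < 4" "?y < 4" "?x \<noteq> ?y"
    using assms by (auto simp: mod_Suc)
  then obtain k m where k: "k < 4" "m < 4" "distinct [?x, ?y, k, m]"
    using two_others by blast
  show ?thesis
  proof (rule C5_in_add_edge[of _ "(?y, 0)" _ "(k, 0)" "(?x, 0)"])
    show "{(?y, 0), (k, 0)} \<in> edges (K4_with_leaves n)" "{(k, 0), (?x, 0)} \<in> edges (K4_with_leaves n)"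
      using x k by (auto intro!: K4_edge)
    show "{(j, b), (?y, 0)} \<in> edges (K4_with_leaves n)" "{(?x, 0), (i, a)} \<in> edges (K4_with_leaves n)"
      using leaf_edge[of j b n] leaf_edge[of i a n] assms by (simp_all add: insert_commute)
  qed (use x k assms in \<open>auto simp: K4_with_leaves_def\<close>)
qed

lemma saturated_K4_with_leaves:
  assumes "1 \<le> n"
  shows "saturated (complete_multipartite 4 n) (cycle_graph 5) (K4_with_leaves n)"
proof -
  let ?G = "complete_multipartite 4 n" and ?H = "K4_with_leaves n"
  have V: "verts ?H = verts ?G"
    by (simp add: K4_with_leaves_def complete_multipartite_def)
  have sub: "edges ?H \<subseteq> edges ?G"
  proof
    fix e assume "e \<in> edges ?H"
    then consider i j where "e = {(i, 0), (j, 0)}" "i < 4" "j < 4" "i \<noteq> j"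
      | i a where "e = {(i, a), (Suc i mod 4, 0)}" "i < 4" "a < n"
      by (auto simp: K4_with_leaves_def K4_edges_def leaf_edges_def)
    then show "e \<in> edges ?G"
    proof cases
      case 1
      then show ?thesis
        using assms by (simp add: edge_complete_multipartite)
    next
      case 2
      then have "i \<noteq> Suc i mod 4"
        by (auto simp: mod_Suc)
      then show ?thesis
        using assms 2 by (simp add: edge_complete_multipartite)
    qed
  qed
  have "simple_graph ?H"
    using simple_graph_complete_multipartite[of 4 n] sub V by (auto simp: simple_graph_def)
  moreover have "contains_copy (add_edge ?H e) (cycle_graph 5)" if e: "e \<in> edges ?G - edges ?H" for e
  proof -
    obtain i a j b where e_def: "e = {(i, a), (j, b)}"
      and ij: "i < 4" "j < 4" "i \<noteq> j" "a < n" "b < n"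
      using e by (auto simp: complete_multipartite_def)
    have flip: "e = {(j, b), (i, a)}"
      using e_def by (simp add: insert_commute)
    consider "a = 0" "b = 0" | "0 < a" "b = 0" | "a = 0" "0 < b" | "0 < a" "0 < b"
      by auto
    then show ?thesis
    proof cases
      case 1
      then show ?thesis
        using e e_def ij K4_edge by auto
    next
      case 2
      then show ?thesis
        using e add_leaf_core_edge[of i j a n] ij unfolding e_def by auto
    next
      case 3
      then show ?thesis
        using e add_leaf_core_edge[of j i b n] ij unfolding flip by auto
    next
      case 4
      then show ?thesis
        using add_leaf_leaf_edge ij unfolding e_def by auto
    qed
  qed
  ultimately show ?thesis
    using V sub K4_with_leaves_C5_free by (simp add: saturated_def spanning_subgraph_def)
qed

theorem theorem1p7:
  fixes n :: nat
  assumes "n \<ge> 10"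
  shows "sat (complete_multipartite 4 n) (cycle_graph 5) = 4 * n + 2"
  unfolding sat_def
proof (rule cInf_eq_minimum)
  show "4 * n + 2 \<in> {card (edges H) | H. saturated (complete_multipartite 4 n) (cycle_graph 5) H}"
    using saturated_K4_with_leaves[of n] card_K4_with_leaves[of n] assms
    by (intro CollectI exI[of _ "K4_with_leaves n"]) simp
next
  fix m assume "m \<in> {card (edges H) | H. saturated (complete_multipartite 4 n) (cycle_graph 5) H}"
  then obtain H where H: "m = card (edges H)" "saturated (complete_multipartite 4 n) (cycle_graph 5) H"
    by blast
  then have "card (verts H) = 4 * n"
    by (simp add: saturated_def spanning_subgraph_def complete_multipartite_def card_cartesian_product)
  then show "4 * n + 2 \<le> m"
    using C5_saturated.card_edges_ge[OF saturated_imp_C5_saturated[OF assms H(2)]] H(1) by simp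
qed

end
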